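(* For any $a\in(0,1)$ there exist $z\in\mathbb{Z}$ and a sequence of integers $n_k$ tending to infinity such that $$\lim_{k\to\infty} \max_{x\in\mathbb{Z}} |\mathcal{F}^a(x) - F_{n_k}(x+k-z)| = 0.$$
   Context: Let $\mathbb{T}$ be the infinite rooted binary tree (every vertex has exactly two children); $|u|$ denotes the level of a vertex $u$ (the root has level $0$). To the edges of $\mathbb{T}$ associate i.i.d. symmetric Bernoulli random variables $B_i$ with $\mathbb{P}(B_i=1)=\mathbb{P}(B_i=-1)=\frac12$. For a vertex $u$, $V(u)$ is the sum of the variables on the edges of the path connecting $u$ with the root (so $V(\text{root})=0$). Let $M_n := \max\{V(u) : |u| = n\}$ and $M_n' := \frac{n-M_n}{2}$, which is a non-negative integer random variable with values in $[0,n]$. Let $F_n(x) := \mathbb{P}(M_n' \ge x)$ for $x\in\mathbb{Z}$, $n\ge 0$. Equivalently, $F_0(x)=1$ for $x\le 0$, $F_0(x)=0$ for $x>0$, and $F_{n+1}(x) = \left[\frac{F_n(x)+F_n(x-1)}{2}\right]^2$. Let $g(y) := 2-y-2\sqrt{1-y}$ and $G(y) := 2\sqrt{y}-y$, which are mutually inverse functions on $[0,1]$; $g^n$ and $G^n$ denote their $n$-th iterates (compositions). For $0<a<1$ define $\mathcal{F}^a:\mathbb{Z}\to(0,1)$ by $$\mathcal{F}^a(m) = \begin{cases} g^m(a), & m>0,\\ a, & m=0,\\ G^{|m|}(a), & m<0.\end{cases}$$ (These are tail functions of distributions on $\mathbb{Z}$ that are invariant: $4\mathcal{F}^a(x) =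 [\mathcal{F}^a(x)+\mathcal{F}^a(x-1)]^2$.) *)

theory Defs
  imports "HOL-Probability.Probability"
begin

text \<open>
  A vertex of the infinite rooted binary tree is the list of left/right choices leading to it
  from the root; the root is the empty list and the level of \<open>u\<close> is \<open>length u\<close>.
  The edge between a non-root vertex and its parent is identified with the non-root vertex, so
  the edges are the nonempty lists; values of \<open>B\<close> at the empty list play no role.
\<close>

definition edges :: "bool list set" where
  "edges = {e. e \<noteq> []}"

locale binary_brw = prob_space M
  for M :: "'w measure" and B :: "bool list \<Rightarrow> 'w \<Rightarrow> real" +
  assumes indep: "indep_vars (\<lambda>_. borel) B edges"
    and prob_plus: "e \<in> edges \<Longrightarrow> prob {\<omega> \<in> space M. B e \<omega> = 1} = 1 / 2"
    and prob_minus: "e \<in> edges \<Longrightarrow> prob {\<omega> \<in> space M. B e \<omega> = - 1} = 1 / 2"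

text \<open>The edges on the path from the root to \<open>u\<close> are the nonempty prefixes of \<open>u\<close>.\<close>

definition brw_V :: "(bool list \<Rightarrow> 'w \<Rightarrow> real) \<Rightarrow> bool list \<Rightarrow> 'w \<Rightarrow> real" where
  "brw_V B u \<omega> = (\<Sum>j = 1..length u. B (take j u) \<omega>)"

definition brw_M :: "(bool list \<Rightarrow> 'w \<Rightarrow> real) \<Rightarrow> nat \<Rightarrow> 'w \<Rightarrow> real" where
  "brw_M B n \<omega> = Max {brw_V B u \<omega> | u. length u = n}"

definition brw_M' :: "(bool list \<Rightarrow> 'w \<Rightarrow> real) \<Rightarrow> nat \<Rightarrow> 'w \<Rightarrow> real" where
  "brw_M' B n \<omega> = (real n - brw_M B n \<omega>) / 2"

definition brw_F :: "'w measure \<Rightarrow> (bool list \<Rightarrow> 'w \<Rightarrow> real) \<Rightarrow> nat \<Rightarrow> int \<Rightarrow> real" where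
  "brw_F M B n x = measure M {\<omega> \<in> space M. brw_M' B n \<omega> \<ge> of_int x}"

definition g :: "real \<Rightarrow> real" where
  "g y = 2 - y - 2 * sqrt (1 - y)"

definition G :: "real \<Rightarrow> real" where
  "G y = 2 * sqrt y - y"

definition inv_tail :: "real \<Rightarrow> int \<Rightarrow> real" where
  "inv_tail a m =
     (if m > 0 then (g ^^ nat m) a else if m = 0 then a else (G ^^ nat \<bar>m\<bar>) a)"

end

theory Submission
  imports Defs
begin

text \<open>
  Splitting the tree at the root shows that the tail function of \<open>M\<^sub>n'\<close> satisfies
  \<open>F\<^sub>n\<^sub>+\<^sub>1(x) = ((F\<^sub>n(x) + F\<^sub>n(x - 1)) / 2)\<^sup>2\<close>, with \<open>F\<^sub>0\<close> the indicator of \<open>x \<le> 0\<close>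
  (lemma \<open>brw_F_eq_tail_rec\<close>); everything else is about this recursion, for
  which the functions \<open>inv_tail a\<close> are stationary. The values \<open>F\<^sub>n(x)\<close> increase in \<open>n\<close>,
  and \<open>F\<^sub>n(x) \<longlonglongrightarrow> 1\<close> for each \<open>x\<close>, so there is a first time \<open>n\<^sub>k\<close> at which
  \<open>F\<^sub>n(k) \<ge> a\<close>. The claim holds with \<open>z = 0\<close> and this \<open>n\<^sub>k\<close>.

  The reason is that time increments become uniformly small:
  \<open>F\<^sub>n\<^sub>+\<^sub>1(x) - F\<^sub>n(x) \<le> 1 / (n + 3)\<close> for all \<open>x\<close> (lemma \<open>tail_rec_increment_le\<close>). Given
  this, \<open>F\<^sub>n(k)\<close> cannot overshoot \<open>a\<close> by more than a vanishing amount at time \<open>n\<^sub>k\<close>; and since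
  \<open>F\<^sub>n\<^sub>k\<close> satisfies the stationary equation up to a vanishing error, its value at
  \<open>k\<close> determines its values at all \<open>k + x\<close> in the limit, by repeated application of \<open>G\<close> to
  the left and of \<open>g\<close> to the right (lemma \<open>tail_rec_tendsto_inv_tail\<close>). Pointwise convergence
  of monotone functions to a tail function is uniform (lemma \<open>uniform_convergence_of_tails\<close>).

  The increment bound comes from a scaling argument in the style of Aronson and Benilan. The
  defect \<open>u = 1 - F\<close> obeys \<open>u\<^sub>n\<^sub>+\<^sub>1 = 2 w - w\<^sup>2\<close>, where \<open>w\<close> is the mean of \<open>u\<^sub>n(x)\<close> and
  \<open>u\<^sub>n(x - 1)\<close>. Its continuous-time analogue is \<open>u' = L u - w\<^sup>2\<close> with
  \<open>(L u)(x) = u(x - 1) \<ge> 0\<close>; there, \<open>v(t) = \<lambda> u(\<lambda> t)\<close> for \<open>\<lambda> \<ge> 1\<close> has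
  \<open>v' = \<lambda> L v - (mean of v)\<^sup>2\<close>, so it is a supersolution that starts above \<open>u\<close>. Hence
  \<open>\<lambda> u(\<lambda> t) \<ge> u(t)\<close>, which says that \<open>t u(t)\<close> is nondecreasing. In discrete time,
  \<open>(n + 3) u\<^sub>n(x)\<close> is nondecreasing in \<open>n\<close> (lemma \<open>scaled_defect_le_Suc\<close>). The discretization
  costs a term that is absorbed wherever \<open>w\<close> is at least about \<open>2 / n\<close>. For \<open>x \<ge> 2\<close> this
  holds because \<open>u\<^sub>n(1)\<close>, the survival probability of a critical branching process, is at least
  \<open>3 / (n + 3)\<close>; at \<open>x = 1\<close> the matching upper bound \<open>4 / (n + 4)\<close> gives the step directly.
\<close>

section \<open>The recursion for the tail function\<close>

fun tail_rec :: "nat \<Rightarrow> int \<Rightarrow> real" where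
  "tail_rec 0 x = (if x \<le> 0 then 1 else 0)"
| "tail_rec (Suc n) x = ((tail_rec n x + tail_rec n (x - 1)) / 2)\<^sup>2"

text \<open>
  The form in which the independence of the edge variables is used: the sets of coordinates may be
  infinite, such as the edges of a subtree.
\<close>

lemma (in prob_space) prob_conj_disjoint_blocks:
  fixes X :: "'i \<Rightarrow> 'a \<Rightarrow> 'b::topological_space"
  assumes "indep_vars (\<lambda>_. borel) X I" "J \<inter> K = {}" "J \<subseteq> I" "K \<subseteq> I"
    and "Measurable.pred (PiM J (\<lambda>_. borel)) P" "Measurable.pred (PiM K (\<lambda>_. borel)) Q"
  shows "prob {\<omega> \<in> space M. P (restrict (\<lambda>i. X i \<omega>) J) \<and> Q (restrict (\<lambda>i. X i \<omega>) K)} =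
    prob {\<omega> \<in> space M. P (restrict (\<lambda>i. X i \<omega>) J)} *
    prob {\<omega> \<in> space M. Q (restrict (\<lambda>i. X i \<omega>) K)}"
proof -
  let ?R = "\<lambda>J \<omega>. restrict (\<lambda>i. X i \<omega>) J"
  let ?S = "\<lambda>J P. {f \<in> space (PiM J (\<lambda>_. borel)). P f}"
  have sp: "?R J \<omega> \<in> space (PiM J (\<lambda>_. borel))" for J \<omega>
    by (auto simp: space_PiM)
  have "indep_var (PiM J (\<lambda>_. borel)) (?R J) (PiM K (\<lambda>_. borel)) (?R K)"
    using indep_var_restrict[OF assms(1-4)] .
  from indep_varD[OF this, of "?S J P" "?S K Q"] assms(5,6)
  have "prob ((\<lambda>x. (?R J x, ?R K x)) -` (?S J P \<times> ?S K Q) \<inter> space M) =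
    prob (?R J -` ?S J P \<inter> space M) * prob (?R K -` ?S K Q \<inter> space M)"
    by (simp add: pred_def)
  moreover have "(\<lambda>x. (?R J x, ?R K x)) -` (?S J P \<times> ?S K Q) \<inter> space M =
      {\<omega> \<in> space M. P (?R J \<omega>) \<and> Q (?R K \<omega>)}"
    using sp by auto
  moreover have "?R J -` ?S J P \<inter> space M = {\<omega> \<in> space M. P (?R J \<omega>)}" for J P
    using sp by auto
  ultimately show ?thesis by simp
qed

text \<open>
  The induction over the level applies to the walks that start at the two children of the root.
\<close>

lemma subtree_binary_brw:
  assumes "binary_brw M B"
  shows "binary_brw M (\<lambda>e. B (c # e))"
proof -
  interpret binary_brw M B by fact
  have "indep_vars (\<lambda>e. PiM {c # e} (\<lambda>_. borel)) (\<lambda>e \<omega>. restrict (\<lambda>i. B i \<omega>) {c # e}) edges"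
    by (rule indep_vars_restrict[OF indep]) (auto simp: edges_def disjoint_family_on_def)
  then have "indep_vars (\<lambda>_. borel) (\<lambda>e \<omega>. (restrict (\<lambda>i. B i \<omega>) {c # e}) (c # e)) edges"
    by (rule indep_vars_compose2) (auto intro: measurable_component_singleton)
  then have "indep_vars (\<lambda>_. borel) (\<lambda>e. B (c # e)) edges" by simp
  then show ?thesis
    using prob_plus prob_minus by unfold_locales (auto simp: edges_def)
qed

lemma brw_V_Cons: "brw_V B (c # u) \<omega> = B [c] \<omega> + brw_V (\<lambda>e. B (c # e)) u \<omega>"
  by (simp add: brw_V_def sum.atLeast1_atMost_eq sum.lessThan_Suc_shift
      del: sum.lessThan_Suc sum.cl_ivl_Suc)

text \<open>
  The event \<open>M\<^sub>n \<le> t\<close>, as a conjunction over the vertices instead of a maximum: in this form it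
  splits at the root without any manipulation of maxima.
\<close>

definition below :: "(bool list \<Rightarrow> 'w \<Rightarrow> real) \<Rightarrow> nat \<Rightarrow> real \<Rightarrow> 'w \<Rightarrow> bool" where
  "below B n t \<omega> \<longleftrightarrow> (\<forall>u. length u = n \<longrightarrow> brw_V B u \<omega> \<le> t)"

lemma brw_M'_ge_iff: "brw_M' B n \<omega> \<ge> of_int x \<longleftrightarrow> below B n (real n - 2 * of_int x) \<omega>"
proof -
  let ?S = "{brw_V B u \<omega> | u. length u = n}"
  have eq: "?S = (\<lambda>u. brw_V B u \<omega>) ` {u. length u = n}" by auto
  have "finite {u::bool list. length u = n}"
    using finite_lists_length_eq[of "UNIV :: bool set" n] by simp
  then have fin: "finite ?S" unfolding eq by simp
  have "length (replicate n True) = n" by simp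
  then have ne: "?S \<noteq> {}" by blast
  have "brw_M' B n \<omega> \<ge> of_int x \<longleftrightarrow> Max ?S \<le> real n - 2 * of_int x"
    unfolding brw_M'_def brw_M_def by (auto simp: field_simps)
  also have "\<dots> \<longleftrightarrow> below B n (real n - 2 * of_int x) \<omega>"
    unfolding below_def using fin ne by (subst Max_le_iff) auto
  finally show ?thesis .
qed

lemma below_Suc:
  "below B (Suc n) t \<omega> \<longleftrightarrow> (\<forall>c. below (\<lambda>e. B (c # e)) n (t - B [c] \<omega>) \<omega>)"
proof -
  have "below B (Suc n) t \<omega> \<longleftrightarrow> (\<forall>c u. length u = n \<longrightarrow> brw_V B (c # u) \<omega> \<le> t)"
    unfolding below_def by (metis length_Suc_conv)
  then show ?thesis by (simp add: below_def brw_V_Cons algebra_simps)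
qed

lemma below_measurable:
  assumes "\<And>e. e \<in> edges \<Longrightarrow> B e \<in> borel_measurable N" and [measurable]: "t \<in> borel_measurable N"
  shows "Measurable.pred N (\<lambda>\<omega>. below B n (t \<omega>) \<omega>)"
proof -
  have [measurable]: "brw_V B u \<in> borel_measurable N" for u
    unfolding brw_V_def by (intro borel_measurable_sum assms) (auto simp: edges_def)
  show ?thesis unfolding below_def by measurable
qed

lemma below_cong:
  assumes "\<And>e. e \<in> edges \<Longrightarrow> B e \<omega> = B' e \<omega>'"
  shows "below B n t \<omega> \<longleftrightarrow> below B' n t \<omega>'"
proof -
  have "brw_V B u \<omega> = brw_V B' u \<omega>'" for u
    unfolding brw_V_def by (intro sum.cong assms) (auto simp: edges_def)
  then show ?thesis by (simp add: below_def)
qed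

context binary_brw
begin

lemma rv_B [measurable]: "e \<in> edges \<Longrightarrow> B e \<in> borel_measurable M"
  using indep by (auto simp: indep_vars_def)

text \<open>
  The two events on the right concern the edges below different children of the root (including
  the edge to the child itself), hence are independent.
\<close>

lemma prob_below_Suc:
  "prob {\<omega> \<in> space M. below B (Suc n) t \<omega>} =
   (\<Prod>c\<in>UNIV. prob {\<omega> \<in> space M. below (\<lambda>e. B (c # e)) n (t - B [c] \<omega>) \<omega>})"
proof -
  let ?K = "\<lambda>c. {e :: bool list. \<exists>w. e = c # w}"
  \<comment> \<open>The events as functions of the edge variables: the walk whose variables are the coordinates.\<close>
  let ?P = "\<lambda>c (f :: bool list \<Rightarrow> real). below (\<lambda>e f. f (c # e)) n (t - f [c]) f"
  let ?R = "\<lambda>c \<omega>. restrict (\<lambda>e. B e \<omega>) (?K c)"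
  have meas: "Measurable.pred (PiM (?K c) (\<lambda>_. borel)) (?P c)" for c
    by (intro below_measurable borel_measurable_diff borel_measurable_const
        measurable_component_singleton) auto
  have P: "?P c (?R c \<omega>) \<longleftrightarrow> below (\<lambda>e. B (c # e)) n (t - B [c] \<omega>) \<omega>" for c \<omega>
  proof -
    have "?P c (?R c \<omega>) \<longleftrightarrow> below (\<lambda>e f. f (c # e)) n (t - B [c] \<omega>) (?R c \<omega>)" by simp
    also have "\<dots> \<longleftrightarrow> below (\<lambda>e. B (c # e)) n (t - B [c] \<omega>) \<omega>" by (rule below_cong) simp
    finally show ?thesis .
  qed
  have "prob {\<omega> \<in> space M. ?P True (?R True \<omega>) \<and> ?P False (?R False \<omega>)} =
     prob {\<omega> \<in> space M. ?P True (?R True \<omega>)} * prob {\<omega> \<in> space M. ?P False (?R False \<omega>)}"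
    by (rule prob_conj_disjoint_blocks[OF indep _ _ _ meas meas]) (auto simp: edges_def)
  then show ?thesis
    unfolding P by (simp add: below_Suc UNIV_bool all_bool_eq mult.commute conj_commute)
qed

text \<open>
  The edge to the child is independent of the edges below it, so one may condition on its value.
\<close>

lemma prob_below_child:
  "prob {\<omega> \<in> space M. below (\<lambda>e. B (c # e)) n (t - B [c] \<omega>) \<omega>} =
    (prob {\<omega> \<in> space M. below (\<lambda>e. B (c # e)) n (t - 1) \<omega>} +
     prob {\<omega> \<in> space M. below (\<lambda>e. B (c # e)) n (t + 1) \<omega>}) / 2"
proof -
  let ?b = "below (\<lambda>e. B (c # e)) n"
  let ?J = "{[c]}" and ?K = "{e :: bool list. \<exists>w\<in>edges. e = c # w}"
  let ?R = "\<lambda>K \<omega>. restrict (\<lambda>e. B e \<omega>) K"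
  have c: "[c] \<in> edges" by (simp add: edges_def)
  note [measurable] = rv_B[OF c]
  have [measurable]: "Measurable.pred M (\<lambda>\<omega>. ?b (r \<omega>) \<omega>)" if "r \<in> borel_measurable M" for r
    using that by (intro below_measurable rv_B) (auto simp: edges_def)
  have m: "Measurable.pred (PiM ?K (\<lambda>_. borel)) (\<lambda>f :: bool list \<Rightarrow> real. below (\<lambda>e f. f (c # e)) n s f)" for s
    by (intro below_measurable borel_measurable_const measurable_component_singleton) auto
  have mJ: "Measurable.pred (PiM ?J (\<lambda>_. borel)) (\<lambda>f :: bool list \<Rightarrow> real. f [c] = s)" for s
    by measurable
  have b: "below (\<lambda>e f. f (c # e)) n s (?R ?K \<omega>) \<longleftrightarrow> ?b s \<omega>" for s \<omega>
    by (rule below_cong) simp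
  have indep': "prob {\<omega> \<in> space M. B [c] \<omega> = v \<and> ?b s \<omega>} =
      prob {\<omega> \<in> space M. B [c] \<omega> = v} * prob {\<omega> \<in> space M. ?b s \<omega>}" for v s
    using prob_conj_disjoint_blocks[OF indep _ _ _ mJ[of v] m[of s]]
    unfolding b by (auto simp: edges_def)
  \<comment> \<open>The two atoms have total mass 1, so other values of the edge variable are negligible.\<close>
  have "prob {\<omega> \<in> space M. B [c] \<omega> = 1 \<or> B [c] \<omega> = -1} =
      prob {\<omega> \<in> space M. B [c] \<omega> = 1} + prob {\<omega> \<in> space M. B [c] \<omega> = -1}"
    by (subst finite_measure_Union[symmetric]) (auto intro!: arg_cong[where f=prob])
  then have "prob {\<omega> \<in> space M. B [c] \<omega> = 1 \<or> B [c] \<omega> = -1} = 1"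
    using prob_plus[OF c] prob_minus[OF c] by simp
  then have ae: "AE \<omega> in M. B [c] \<omega> = 1 \<or> B [c] \<omega> = -1"
    by (subst (asm) prob_Collect_eq_1) measurable
  have "prob {\<omega> \<in> space M. ?b (t - B [c] \<omega>) \<omega>} =
      prob ({\<omega> \<in> space M. B [c] \<omega> = 1 \<and> ?b (t - 1) \<omega>} \<union> {\<omega> \<in> space M. B [c] \<omega> = -1 \<and> ?b (t + 1) \<omega>})"
    using ae by (intro finite_measure_eq_AE) auto
  also have "\<dots> = prob {\<omega> \<in> space M. B [c] \<omega> = 1 \<and> ?b (t - 1) \<omega>}
      + prob {\<omega> \<in> space M. B [c] \<omega> = -1 \<and> ?b (t + 1) \<omega>}"
    by (intro finite_measure_Union) auto
  finally show ?thesis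
    using prob_plus[OF c] prob_minus[OF c] by (simp add: indep')
qed

end

lemma prob_below_eq_tail_rec:
  assumes "binary_brw M B"
  shows "measure M {\<omega> \<in> space M. below B n (real n - 2 * of_int x) \<omega>} = tail_rec n x"
  using assms
proof (induction n arbitrary: B x)
  case 0
  interpret binary_brw M B by fact
  have "x > 0 \<Longrightarrow> \<not> real_of_int x \<le> 0" by simp
  then show ?case by (auto simp: below_def brw_V_def prob_space)
next
  case (Suc n)
  interpret binary_brw M B by fact
  have child: "prob {\<omega> \<in> space M. below (\<lambda>e. B (c # e)) n (real (Suc n) - 2 * of_int x - B [c] \<omega>) \<omega>}
      = (tail_rec n x + tail_rec n (x - 1)) / 2" for c
    using Suc.IH[OF subtree_binary_brw[OF Suc.prems], of c x]
      Suc.IH[OF subtree_binary_brw[OF Suc.prems], of c "x - 1"]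
    by (subst prob_below_child) (simp add: algebra_simps)
  then show ?case
    unfolding prob_below_Suc child by (simp add: UNIV_bool power2_eq_square)
qed

lemma brw_F_eq_tail_rec:
  assumes "binary_brw M B"
  shows "brw_F M B n x = tail_rec n x"
  using prob_below_eq_tail_rec[OF assms] by (simp add: brw_F_def brw_M'_ge_iff)

section \<open>Monotonicity in space and time\<close>

lemma tail_rec_bounds: "0 \<le> tail_rec n x \<and> tail_rec n x \<le> 1"
proof (induction n arbitrary: x)
  case (Suc n)
  have "((tail_rec n x + tail_rec n (x - 1)) / 2)\<^sup>2 \<le> 1\<^sup>2"
    using Suc[of x] Suc[of "x - 1"] by (intro power_mono) auto
  then show ?case by simp
qed simp

lemma tail_rec_eq_1: "x \<le> 0 \<Longrightarrow> tail_rec n x = 1"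
  by (induction n arbitrary: x) auto

lemma tail_rec_eq_0: "x > int n \<Longrightarrow> tail_rec n x = 0"
  by (induction n arbitrary: x) auto

lemma antimono_tail_rec: "antimono (tail_rec n)"
proof (induction n)
  case (Suc n)
  show ?case
  proof (rule antimonoI)
    fix x y :: int assume "x \<le> y"
    then show "tail_rec (Suc n) y \<le> tail_rec (Suc n) x"
      using antimonoD[OF Suc, of x y] antimonoD[OF Suc, of "x - 1" "y - 1"]
        tail_rec_bounds[of n y] tail_rec_bounds[of n "y - 1"]
      by (auto intro!: power_mono)
  qed
qed (auto simp: antimono_def)

lemma tail_rec_le_Suc: "tail_rec n x \<le> tail_rec (Suc n) x"
proof (induction n arbitrary: x)
  case 0
  then show ?case by simp
next
  case (Suc n)
  have "((tail_rec n x + tail_rec n (x - 1)) / 2)\<^sup>2 \<le>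
      ((tail_rec (Suc n) x + tail_rec (Suc n) (x - 1)) / 2)\<^sup>2"
    using Suc[of x] Suc[of "x - 1"] tail_rec_bounds[of n x] tail_rec_bounds[of n "x - 1"]
    by (intro power_mono) auto
  then show ?case by (simp only: tail_rec.simps(2))
qed

lemma mono_tail_rec: "m \<le> n \<Longrightarrow> tail_rec m x \<le> tail_rec n x"
  by (rule lift_Suc_mono_le) (rule tail_rec_le_Suc)

section \<open>Decay of the time increments\<close>

text \<open>
  The defect \<open>u = 1 - F\<close> at \<open>x = 1\<close> obeys \<open>u\<^sub>n\<^sub>+\<^sub>1 = u\<^sub>n - u\<^sub>n\<^sup>2 / 4\<close>, so it behaves like \<open>4 / n\<close>;
  the lower constant is only \<open>3\<close> because \<open>4 / (n + c)\<close> is slightly too large, for every \<open>c\<close>, by a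
  logarithmic correction.
\<close>

lemma tail_rec_1_bounds:
  "3 / (real n + 3) \<le> 1 - tail_rec n 1 \<and> 1 - tail_rec n 1 \<le> 4 / (real n + 4)"
proof (induction n)
  case (Suc n)
  define u where "u = 1 - tail_rec n 1"
  have u: "3 / (real n + 3) \<le> u" "u \<le> 4 / (real n + 4)" using Suc by (auto simp: u_def)
  have step: "1 - tail_rec (Suc n) 1 = u - u\<^sup>2 / 4"
    by (simp add: tail_rec_eq_1 u_def power2_eq_square field_simps)
  have mono: "v - v\<^sup>2 / 4 \<le> w - w\<^sup>2 / 4" if "v \<le> w" "w \<le> 1" for v w :: real
  proof -
    have "0 \<le> (w - v) * (1 - (w + v) / 4)" using that by (intro mult_nonneg_nonneg) auto
    then show ?thesis by (simp add: power2_eq_square field_simps)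
  qed
  have "3 / (real (Suc n) + 3) \<le> 3 / (real n + 3) - (3 / (real n + 3))\<^sup>2 / 4"
    by (simp add: power2_eq_square divide_simps) (simp add: algebra_simps)
  also have "\<dots> \<le> u - u\<^sup>2 / 4" using u by (intro mono) (auto simp: u_def tail_rec_bounds)
  finally have 1: "3 / (real (Suc n) + 3) \<le> u - u\<^sup>2 / 4" .
  have "u - u\<^sup>2 / 4 \<le> 4 / (real n + 4) - (4 / (real n + 4))\<^sup>2 / 4"
    using u by (intro mono) auto
  also have "\<dots> \<le> 4 / (real (Suc n) + 4)"
    by (simp add: power2_eq_square divide_simps) (simp add: algebra_simps)
  finally show ?case using 1 by (simp only: step)
qed simp

lemma one_minus_tail_rec_Suc:
  "1 - tail_rec (Suc n) x = (let w = 1 - (tail_rec n x + tail_rec n (x - 1)) / 2 in 2 * w - w\<^sup>2)"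
  by (simp add: Let_def power2_eq_square algebra_simps)

text \<open>
  One step of the scaling argument, with \<open>w\<close> and \<open>w'\<close> the spatial means of the defect at two
  consecutive times. Replacing \<open>w'\<close> by its lower bound \<open>v = N w / (N + 1)\<close>, the linear terms
  fall short by \<open>2 w / (N + 1)\<close>, because \<open>N (N + 2) < (N + 1)\<^sup>2\<close>, while the quadratic terms
  gain nearly \<open>w\<^sup>2\<close>. The gain wins when \<open>w\<close> exceeds about \<open>2 / N\<close>.
\<close>

lemma quadratic_step:
  fixes N w w' :: real
  assumes N: "3 \<le> N" and w: "3 / N \<le> w" and w': "N * w \<le> (N + 1) * w'" "w' \<le> 1"
  shows "(N + 1) * (2 * w - w\<^sup>2) \<le> (N + 2) * (2 * w' - w'\<^sup>2)"
proof -
  define v where "v = N * w / (N + 1)"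
  have Nw: "3 \<le> N * w" using w N by (simp add: field_simps)
  have "0 < 3 / N" using N by simp
  with w have w0: "0 < w" by linarith
  have v: "v \<le> w'" using w' N by (simp add: v_def field_simps)
  have "0 \<le> (w' - v) * (2 - w' - v)" using v w' by (intro mult_nonneg_nonneg) auto
  then have "2 * v - v\<^sup>2 \<le> 2 * w' - w'\<^sup>2" by (simp add: power2_eq_square algebra_simps)
  then have 1: "(N + 2) * (2 * v - v\<^sup>2) \<le> (N + 2) * (2 * w' - w'\<^sup>2)"
    using N by (intro mult_left_mono) auto
  have "(N + 1)\<^sup>2 * ((N + 2) * (2 * v - v\<^sup>2) - (N + 1) * (2 * w - w\<^sup>2)) =
      w * ((N\<^sup>2 + 3 * N + 1) * w - 2 * (N + 1))"
    using N unfolding v_def by (simp add: power2_eq_square divide_simps) (simp add: algebra_simps)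
  moreover have "2 * (N + 1) \<le> (N + 3) * (N * w)"
    using mult_left_mono[OF Nw, of "N + 3"] N by simp
  then have "0 \<le> w * ((N\<^sup>2 + 3 * N + 1) * w - 2 * (N + 1))"
    using w0 by (intro mult_nonneg_nonneg) (auto simp: power2_eq_square algebra_simps)
  ultimately have "(N + 1)\<^sup>2 * 0 \<le> (N + 1)\<^sup>2 * ((N + 2) * (2 * v - v\<^sup>2) - (N + 1) * (2 * w - w\<^sup>2))"
    by (simp only: mult_zero_right)
  moreover have "0 < (N + 1)\<^sup>2" using N by simp
  ultimately have "0 \<le> (N + 2) * (2 * v - v\<^sup>2) - (N + 1) * (2 * w - w\<^sup>2)"
    by (simp only: mult_le_cancel_left_pos)
  with 1 show ?thesis by simp
qed

text \<open>
  The offset \<open>3\<close> is the largest possible, since the two sides agree at \<open>n = 0\<close>, \<open>x = 1\<close>. With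
  it, the step at \<open>x = 1\<close> amounts to \<open>u\<^sub>n(1) \<le> 4 / (n + 4)\<close>, where \<open>u = 1 - F\<close>.
\<close>

lemma scaled_defect_le_Suc:
  "(real n + 3) * (1 - tail_rec n x) \<le> (real n + 4) * (1 - tail_rec (Suc n) x)"
proof (induction n arbitrary: x)
  case 0
  have "x \<le> 0 \<or> x = 1 \<or> x \<ge> 2" by linarith
  then show ?case by (auto simp: power2_eq_square)
next
  case (Suc n)
  consider "x \<le> 0" | "x = 1" | "x \<ge> 2" by linarith
  then show ?case
  proof cases
    case 1
    then show ?thesis by (simp add: tail_rec_eq_1 del: tail_rec.simps)
  next
    case 2
    define u where "u = 1 - tail_rec (Suc n) 1"
    have u: "0 \<le> u" "(real n + 5) * u \<le> 4"
      using tail_rec_1_bounds[of "Suc n"] tail_rec_bounds[of "Suc n" 1]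
      unfolding u_def by (auto simp: field_simps)
    have step: "1 - tail_rec (Suc (Suc n)) 1 = u - u\<^sup>2 / 4"
      unfolding u_def tail_rec.simps(2)[of "Suc n"]
      by (simp add: tail_rec_eq_1 power2_eq_square field_simps del: tail_rec.simps(2))
    have "(real n + 4) * u \<le> (real n + 5) * (u - u\<^sup>2 / 4)"
      using mult_left_mono[OF u(2) u(1)] by (simp add: power2_eq_square algebra_simps)
    then show ?thesis unfolding 2 step u_def[symmetric] by (simp add: add.commute)
  next
    case 3
    define w where "w = 1 - (tail_rec n x + tail_rec n (x - 1)) / 2"
    define w' where "w' = 1 - (tail_rec (Suc n) x + tail_rec (Suc n) (x - 1)) / 2"
    have "tail_rec n x \<le> tail_rec n 1" "tail_rec n (x - 1) \<le> tail_rec n 1"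
      using 3 by (auto intro!: antimonoD[OF antimono_tail_rec])
    then have "(tail_rec n x + tail_rec n (x - 1)) / 2 \<le> tail_rec n 1" by simp
    then have "1 - tail_rec n 1 \<le> w" unfolding w_def by linarith
    then have w: "3 / (real n + 3) \<le> w" using order_trans tail_rec_1_bounds by blast
    have w': "w' \<le> 1" unfolding w'_def
      using tail_rec_bounds[of "Suc n" x] tail_rec_bounds[of "Suc n" "x - 1"]
      by (simp del: tail_rec.simps)
    have mean: "c * (1 - (p + q) / 2) = (c * (1 - p) + c * (1 - q)) / 2" for c p q :: real
      by (simp add: field_simps)
    have "(real n + 3) * w \<le> (real n + 4) * w'"
      unfolding w_def w'_def mean by (intro divide_right_mono add_mono Suc.IH) simp
    then have "(real n + 3) * w \<le> (real n + 3 + 1) * w'" by (simp add: add.commute)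
    from quadratic_step[OF _ w this w']
    have "(real n + 3 + 1) * (2 * w - w\<^sup>2) \<le> (real n + 3 + 2) * (2 * w' - w'\<^sup>2)" by simp
    moreover have "1 - tail_rec (Suc n) x = 2 * w - w\<^sup>2"
      and "1 - tail_rec (Suc (Suc n)) x = 2 * w' - w'\<^sup>2"
      unfolding w_def w'_def one_minus_tail_rec_Suc Let_def by (rule refl)+
    moreover have "real (Suc n) + 3 = real n + 3 + 1" "real (Suc n) + 4 = real n + 3 + 2" by simp_all
    ultimately show ?thesis by (simp only:)
  qed
qed

text \<open>
  Monotonicity of \<open>(n + 3) u\<^sub>n\<close> bounds the relative decrease of \<open>u\<^sub>n\<close> in one step, and \<open>u \<le> 1\<close>.
\<close>

lemma tail_rec_increment_le: "tail_rec (Suc n) x - tail_rec n x \<le> 1 / (real n + 3)"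
proof -
  have "(real n + 3) * (tail_rec (Suc n) x - tail_rec n x) \<le> 1 - tail_rec (Suc n) x"
    using scaled_defect_le_Suc[of n x] by (simp only: algebra_simps)
  also have "\<dots> \<le> 1" using tail_rec_bounds[of "Suc n" x] by linarith
  finally show ?thesis by (simp add: pos_le_divide_eq mult.commute del: tail_rec.simps)
qed

section \<open>Passage times\<close>

text \<open>
  By induction on the position: if the value at \<open>k\<close> tends to \<open>1\<close>, the limit \<open>L\<close> at \<open>k + 1\<close>
  solves \<open>L = ((L + 1) / 2)\<^sup>2\<close>, whose only root is the double root \<open>1\<close>.
\<close>

lemma tail_rec_tendsto_1: "(\<lambda>n. tail_rec n (int k)) \<longlonglongrightarrow> 1"
proof (induction k)
  case 0
  then show ?case by (simp add: tail_rec_eq_1)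
next
  case (Suc k)
  have "convergent (\<lambda>n. tail_rec n (int (Suc k)))"
    by (intro Bseq_mono_convergent BseqI'[where K=1]) (auto simp: tail_rec_bounds intro: mono_tail_rec)
  then obtain L where L: "(\<lambda>n. tail_rec n (int (Suc k))) \<longlonglongrightarrow> L" by (auto simp: convergent_def)
  have "(\<lambda>n. tail_rec (Suc n) (int (Suc k))) \<longlonglongrightarrow> ((L + 1) / 2)\<^sup>2"
    unfolding tail_rec.simps using L Suc by (intro tendsto_intros) auto
  with LIMSEQ_Suc[OF L] have "L = ((L + 1) / 2)\<^sup>2" by (rule LIMSEQ_unique)
  then have "(L - 1)\<^sup>2 = 0" by (simp add: power2_eq_square field_simps)
  with L show ?case by simp
qed

definition passage_time :: "real \<Rightarrow> nat \<Rightarrow> nat" where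
  "passage_time a k = (LEAST n. a \<le> tail_rec n (int k))"

text \<open>
  The level \<open>a\<close> is eventually exceeded because \<open>F\<^sub>n(k) \<longlonglongrightarrow> 1\<close>, and not before time \<open>k\<close>
  because \<open>F\<^sub>n\<close> vanishes beyond \<open>n\<close>.
\<close>

lemma passage_time:
  assumes "0 < a" "a < 1"
  shows "a \<le> tail_rec (passage_time a k) (int k)" "k \<le> passage_time a k"
    "n < passage_time a k \<Longrightarrow> tail_rec n (int k) < a"
proof -
  have "\<forall>\<^sub>F n in sequentially. a < tail_rec n (int k)"
    using tail_rec_tendsto_1 assms by (intro order_tendstoD) auto
  then have "\<exists>n. a \<le> tail_rec n (int k)"
    by (meson eventually_happens less_imp_le trivial_limit_sequentially)
  then show 1: "a \<le> tail_rec (passage_time a k) (int k)"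
    unfolding passage_time_def by (rule LeastI_ex)
  show "k \<le> passage_time a k"
    using 1 tail_rec_eq_0[of "passage_time a k" "int k"] assms by (cases "k \<le> passage_time a k") auto
  show "n < passage_time a k \<Longrightarrow> tail_rec n (int k) < a"
    unfolding passage_time_def by (auto dest: not_less_Least)
qed

lemma passage_time_at_top:
  assumes "0 < a" "a < 1"
  shows "filterlim (passage_time a) at_top sequentially"
  using passage_time(2)[OF assms] by (intro filterlim_at_top_mono[OF filterlim_ident]) auto

text \<open>
  Just before its passage time the value at \<open>k\<close> is below \<open>a\<close>, so it overshoots \<open>a\<close> by at most
  one increment.
\<close>

lemma tail_rec_passage_time_tendsto:
  assumes a: "0 < a" "a < 1"
  shows "(\<lambda>k. tail_rec (passage_time a k) (int k)) \<longlonglongrightarrow> a"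
proof (rule tendsto_sandwich[OF _ _ tendsto_const])
  show "\<forall>\<^sub>F k in sequentially. a \<le> tail_rec (passage_time a k) (int k)"
    using passage_time(1)[OF a] by simp
  have "(\<lambda>m. a + 1 / (real m + 2)) \<longlonglongrightarrow> a"
    using tendsto_add[OF tendsto_const LIMSEQ_ignore_initial_segment[OF lim_1_over_n, of 2], of a]
    by (simp add: add.commute)
  from filterlim_compose[OF this passage_time_at_top[OF a]]
  show "(\<lambda>k. a + 1 / (real (passage_time a k) + 2)) \<longlonglongrightarrow> a" .
  show "\<forall>\<^sub>F k in sequentially. tail_rec (passage_time a k) (int k) \<le> a + 1 / (real (passage_time a k) + 2)"
    \<comment> \<open>For \<open>k = 0\<close> the passage time is \<open>0\<close> and there is no previous time.\<close>
    using eventually_gt_at_top[of 0]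
  proof eventually_elim
    case (elim k)
    with passage_time(2)[OF a, of k] obtain m where m: "passage_time a k = Suc m"
      by (metis gr0_conv_Suc order_less_le_trans)
    then show ?case
      using passage_time(3)[OF a, of m k] tail_rec_increment_le[of m "int k"]
      by (simp del: tail_rec.simps add: add.commute)
  qed
qed

section \<open>The invariant tail functions\<close>

lemma g_eq: "y \<le> 1 \<Longrightarrow> g y = (1 - sqrt (1 - y))\<^sup>2"
  by (simp add: g_def power2_eq_square algebra_simps)

lemma one_minus_G_eq: "0 \<le> y \<Longrightarrow> 1 - G y = (1 - sqrt y)\<^sup>2"
  by (simp add: G_def power2_eq_square algebra_simps)

lemma le_sqrt_self: "0 \<le> y \<Longrightarrow> y \<le> 1 \<Longrightarrow> y \<le> sqrt y"
  by (rule real_le_rsqrt) (simp add: power2_eq_square mult_left_le)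

text \<open>
  The bounds by squares make the iterates of \<open>g\<close> tend to \<open>0\<close> and those of \<open>G\<close> tend to \<open>1\<close> at least
  geometrically, and they contain the monotonicity \<open>g y \<le> y \<le> G y\<close>.
\<close>

lemma g_bounds:
  assumes "0 \<le> y" "y \<le> 1"
  shows "0 \<le> g y" "g y \<le> y\<^sup>2"
  using assms le_sqrt_self[of "1 - y"] by (auto simp: g_eq intro!: power_mono)

lemma one_minus_G_bounds:
  assumes "0 \<le> y" "y \<le> 1"
  shows "0 \<le> 1 - G y" "1 - G y \<le> (1 - y)\<^sup>2"
  using assms le_sqrt_self[of y] by (auto simp: one_minus_G_eq intro!: power_mono)

lemma inv_tail_0 [simp]: "inv_tail a 0 = a"
  by (simp add: inv_tail_def)

lemma inv_tail_pos: "inv_tail a (int (Suc m)) = g (inv_tail a (int m))"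
  by (auto simp: inv_tail_def nat_add_distrib)

lemma inv_tail_neg: "inv_tail a (- int (Suc m)) = G (inv_tail a (- int m))"
  by (auto simp: inv_tail_def nat_add_distrib)

lemma inv_tail_pos_bounds:
  assumes "0 < a" "a < 1"
  shows "0 \<le> inv_tail a (int m) \<and> inv_tail a (int m) \<le> a * a ^ m"
proof (induction m)
  case (Suc m)
  let ?y = "inv_tail a (int m)"
  have am: "a * a ^ m \<le> a" using assms by (simp add: power_le_one)
  have "g ?y \<le> ?y * ?y"
    using g_bounds[of ?y] Suc am assms by (simp add: power2_eq_square)
  also have "\<dots> \<le> a * (a * a ^ m)" using Suc am by (intro mult_mono) auto
  finally show ?case unfolding inv_tail_pos using g_bounds(1)[of ?y] Suc am assms by simp
qed (use assms in simp)

lemma inv_tail_neg_bounds: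
  assumes "0 < a" "a < 1"
  shows "0 \<le> 1 - inv_tail a (- int m) \<and> 1 - inv_tail a (- int m) \<le> (1 - a) * (1 - a) ^ m"
proof (induction m)
  case (Suc m)
  let ?y = "inv_tail a (- int m)"
  have am: "(1 - a) * (1 - a) ^ m \<le> 1 - a" using assms by (simp add: power_le_one mult_left_le)
  have "1 - G ?y \<le> (1 - ?y) * (1 - ?y)"
    using one_minus_G_bounds[of ?y] Suc am assms by (simp add: power2_eq_square)
  also have "\<dots> \<le> (1 - a) * ((1 - a) * (1 - a) ^ m)" using Suc am by (intro mult_mono) auto
  finally show ?case unfolding inv_tail_neg using one_minus_G_bounds(1)[of ?y] Suc am assms by simp
qed (use assms in simp)

lemma inv_tail_bounds:
  assumes "0 < a" "a < 1"
  shows "0 \<le> inv_tail a x \<and> inv_tail a x \<le> 1"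
proof (cases x rule: int_cases2)
  case (nonneg m)
  have "a * a ^ m \<le> 1" using assms by (simp add: power_le_one mult_le_one)
  with inv_tail_pos_bounds[OF assms, of m] nonneg show ?thesis by simp
next
  case (nonpos m)
  have "(1 - a) * (1 - a) ^ m \<le> 1" using assms by (simp add: power_le_one mult_le_one)
  with inv_tail_neg_bounds[OF assms, of m] nonpos show ?thesis by simp
qed

lemma antimono_inv_tail:
  assumes "0 < a" "a < 1"
  shows "antimono (inv_tail a)"
proof -
  have sq: "t\<^sup>2 \<le> t" if "0 \<le> t" "t \<le> 1" for t :: real
    using that by (simp add: power2_eq_square mult_left_le)
  have pos: "inv_tail a (int (Suc m)) \<le> inv_tail a (int m)" for m
    unfolding inv_tail_pos
    using g_bounds(2)[of "inv_tail a (int m)"] sq[of "inv_tail a (int m)"]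
      inv_tail_bounds[OF assms, of "int m"] by linarith
  have neg: "inv_tail a (- int m) \<le> inv_tail a (- int (Suc m))" for m
    unfolding inv_tail_neg
    using one_minus_G_bounds(2)[of "inv_tail a (- int m)"] sq[of "1 - inv_tail a (- int m)"]
      inv_tail_bounds[OF assms, of "- int m"] by linarith
  have step: "inv_tail a (x + 1) \<le> inv_tail a x" for x
  proof (cases "x \<ge> 0")
    case True
    then show ?thesis using pos[of "nat x"] by (simp add: add.commute)
  next
    case False
    then show ?thesis using neg[of "nat (- x - 1)"] by (simp add: add.commute)
  qed
  have "inv_tail a (x + int d) \<le> inv_tail a x" for x d
  proof (induction d)
    case (Suc d)
    with step[of "x + int d"] show ?case by (simp add: ac_simps)
  qed simp
  then show ?thesis
    by (intro antimonoI) (metis zle_iff_zadd)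
qed

lemma inv_tail_tendsto:
  assumes "0 < a" "a < 1"
  shows "(inv_tail a \<longlongrightarrow> 1) at_bot" "(inv_tail a \<longlongrightarrow> 0) at_top"
proof -
  have "(\<lambda>m. a * a ^ m) \<longlonglongrightarrow> a * 0" "(\<lambda>m. (1 - a) * (1 - a) ^ m) \<longlonglongrightarrow> (1 - a) * 0"
    using assms by (auto intro!: tendsto_mult LIMSEQ_power_zero)
  then have lims: "\<forall>\<^sub>F m in sequentially. a * a ^ m < e" "\<forall>\<^sub>F m in sequentially. (1 - a) * (1 - a) ^ m < e"
    if "0 < e" for e using that by (auto intro: order_tendstoD)
  show "(inv_tail a \<longlongrightarrow> 0) at_top"
  proof (rule order_tendstoI)
    fix e :: real assume "0 < e"
    then obtain m where "a * a ^ m < e"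
      using lims(1) by (meson eventually_happens trivial_limit_sequentially)
    then have "inv_tail a x < e" if "x \<ge> int m" for x
      using inv_tail_pos_bounds[OF assms, of m] antimonoD[OF antimono_inv_tail[OF assms] that]
      by linarith
    then show "\<forall>\<^sub>F x in at_top. inv_tail a x < e" by (auto simp: eventually_at_top_linorder)
  next
    fix e :: real assume "e < 0"
    then show "\<forall>\<^sub>F x in at_top. e < inv_tail a x"
      using inv_tail_bounds[OF assms] by (auto intro!: always_eventually elim: less_le_trans)
  qed
  show "(inv_tail a \<longlongrightarrow> 1) at_bot"
  proof (rule order_tendstoI)
    fix e :: real assume "e < 1"
    then obtain m where "(1 - a) * (1 - a) ^ m < 1 - e"
      using lims(2)[of "1 - e"] by (meson diff_gt_0_iff_gt eventually_happens trivial_limit_sequentially)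
    then have "e < inv_tail a x" if "x \<le> - int m" for x
      using inv_tail_neg_bounds[OF assms, of m] antimonoD[OF antimono_inv_tail[OF assms] that]
      by linarith
    then show "\<forall>\<^sub>F x in at_bot. e < inv_tail a x" by (auto simp: eventually_at_bot_linorder)
  next
    fix e :: real assume "1 < e"
    then show "\<forall>\<^sub>F x in at_bot. inv_tail a x < e"
      using inv_tail_bounds[OF assms] by (auto intro!: always_eventually intro: le_less_trans)
  qed
qed

section \<open>Convergence to the invariant tail function\<close>

text \<open>
  Polya's argument: outside a finite interval \<open>H\<close> is within \<open>e / 2\<close> of \<open>0\<close> or \<open>1\<close>, and
  monotonicity carries the bound at the end points of the interval over to \<open>f k\<close> on both sides.
\<close>

lemma uniform_convergence_of_tails:
  fixes f :: "nat \<Rightarrow> int \<Rightarrow> real" and H :: "int \<Rightarrow> real"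
  assumes f: "\<And>k. antimono (f k)" "\<And>k x. 0 \<le> f k x \<and> f k x \<le> 1"
    and H: "antimono H" "\<And>x. 0 \<le> H x \<and> H x \<le> 1"
    and lims: "(H \<longlongrightarrow> 1) at_bot" "(H \<longlongrightarrow> 0) at_top"
    and conv: "\<And>x. (\<lambda>k. f k x) \<longlonglongrightarrow> H x"
    and e: "0 < e"
  shows "\<forall>\<^sub>F k in sequentially. \<forall>x. \<bar>H x - f k x\<bar> < e"
proof -
  have "\<forall>\<^sub>F x in at_bot. H x > 1 - e / 2" using lims(1) e by (intro order_tendstoD) auto
  then obtain p where p: "H p > 1 - e / 2" by (auto simp: eventually_at_bot_linorder)
  have "\<forall>\<^sub>F x in at_top. H x < e / 2" using lims(2) e by (intro order_tendstoD) auto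
  then obtain q where q: "H q < e / 2" by (auto simp: eventually_at_top_linorder)
  \<comment> \<open>The end points are listed separately because \<open>{p..q}\<close> may be empty.\<close>
  have "\<forall>\<^sub>F k in sequentially. \<forall>x\<in>{p..q} \<union> {p, q}. dist (f k x) (H x) < e / 2"
    using e by (intro eventually_ball_finite ballI tendstoD[OF conv]) auto
  then show ?thesis
  proof eventually_elim
    case (elim k)
    show ?case
    proof
      fix x
      consider "x \<in> {p..q}" | "x \<le> p" | "x \<ge> q" by force
      then show "\<bar>H x - f k x\<bar> < e"
      proof cases
        case 1
        with elim have "dist (f k x) (H x) < e / 2" by blast
        with e show ?thesis unfolding dist_real_def by linarith
      next
        case 2
        have "dist (f k p) (H p) < e / 2" using elim by blast
        with p e antimonoD[OF H(1) 2] antimonoD[OF f(1) 2, of k] H(2)[of x] f(2)[of k x]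
        show ?thesis unfolding dist_real_def by linarith
      next
        case 3
        have "dist (f k q) (H q) < e / 2" using elim by blast
        with q e antimonoD[OF H(1) 3] antimonoD[OF f(1) 3, of k] H(2)[of x] f(2)[of k x]
        show ?thesis unfolding dist_real_def by linarith
      qed
    qed
  qed
qed

text \<open>
  Along times \<open>n k\<close> that tend to infinity the recursion becomes the stationary equation
  \<open>4 y = (y + y')\<^sup>2\<close> for the limits \<open>y\<close> and \<open>y'\<close> at a position and at its left neighbour. The next
  lemmas solve it for \<open>y'\<close>, which gives \<open>G y\<close>, and for \<open>y\<close>, which gives \<open>g y'\<close>.
\<close>

context
  fixes n :: "nat \<Rightarrow> nat" and s :: "nat \<Rightarrow> int"
  assumes n: "filterlim n at_top sequentially"
begin

lemma increment_tendsto_0: "(\<lambda>k. tail_rec (Suc (n k)) (s k) - tail_rec (n k) (s k)) \<longlonglongrightarrow> 0"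
proof (rule tendsto_sandwich[OF _ _ tendsto_const])
  have "(\<lambda>m. 1 / (real m + 3)) \<longlonglongrightarrow> 0"
    using LIMSEQ_ignore_initial_segment[OF lim_1_over_n, of 3] by (simp add: add.commute)
  from filterlim_compose[OF this n] show "(\<lambda>k. 1 / (real (n k) + 3)) \<longlonglongrightarrow> 0" .
qed (use tail_rec_increment_le tail_rec_le_Suc in \<open>auto simp del: tail_rec.simps\<close>)

lemma left_neighbour_tendsto:
  assumes "(\<lambda>k. tail_rec (n k) (s k)) \<longlonglongrightarrow> y"
  shows "(\<lambda>k. tail_rec (n k) (s k - 1)) \<longlonglongrightarrow> G y"
proof -
  have "tail_rec (n k) (s k - 1) = 2 * sqrt (tail_rec (Suc (n k)) (s k)) - tail_rec (n k) (s k)" for k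
  proof -
    have "sqrt (tail_rec (Suc (n k)) (s k)) = (tail_rec (n k) (s k) + tail_rec (n k) (s k - 1)) / 2"
      unfolding tail_rec.simps(2)
      using tail_rec_bounds[of "n k" "s k"] tail_rec_bounds[of "n k" "s k - 1"]
      by (intro real_sqrt_unique) auto
    then show ?thesis by argo
  qed
  moreover have "(\<lambda>k. tail_rec (Suc (n k)) (s k)) \<longlonglongrightarrow> y"
    using tendsto_add[OF increment_tendsto_0 assms] by (simp del: tail_rec.simps)
  then have "(\<lambda>k. 2 * sqrt (tail_rec (Suc (n k)) (s k)) - tail_rec (n k) (s k)) \<longlonglongrightarrow> 2 * sqrt y - y"
    using assms by (intro tendsto_intros)
  ultimately show ?thesis by (simp add: G_def)
qed

text \<open>
  The exact value at \<open>s k\<close> is expressed by the value at its left neighbour and the increment \<open>?d k\<close>,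
  in a form that is continuous in both: if \<open>A\<close> is the mean of the two values, then \<open>A\<^sup>2\<close> is the
  next value at \<open>s k\<close>, and \<open>(1 - A)\<^sup>2\<close> involves only the left neighbour and the increment.
\<close>

lemma right_neighbour_tendsto:
  assumes "(\<lambda>k. tail_rec (n k) (s k - 1)) \<longlonglongrightarrow> y" "y \<le> 1"
  shows "(\<lambda>k. tail_rec (n k) (s k)) \<longlonglongrightarrow> g y"
proof -
  let ?d = "\<lambda>k. tail_rec (Suc (n k)) (s k) - tail_rec (n k) (s k)"
  have "tail_rec (n k) (s k) = (1 - sqrt (1 - tail_rec (n k) (s k - 1) + ?d k))\<^sup>2 - ?d k" for k
  proof -
    define A where "A = (tail_rec (n k) (s k) + tail_rec (n k) (s k - 1)) / 2"
    have A: "A \<le> 1" "tail_rec (Suc (n k)) (s k) = A\<^sup>2"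
      unfolding A_def using tail_rec_bounds[of "n k" "s k"] tail_rec_bounds[of "n k" "s k - 1"] by auto
    have "1 - tail_rec (n k) (s k - 1) + ?d k = (1 - A)\<^sup>2"
      unfolding A(2) by (simp add: A_def power2_eq_square field_simps)
    then have "sqrt (1 - tail_rec (n k) (s k - 1) + ?d k) = 1 - A" using A by simp
    then show ?thesis using A(2) by simp
  qed
  moreover have "(\<lambda>k. (1 - sqrt (1 - tail_rec (n k) (s k - 1) + ?d k))\<^sup>2 - ?d k) \<longlonglongrightarrow>
      (1 - sqrt (1 - y + 0))\<^sup>2 - 0"
    using assms by (intro tendsto_intros increment_tendsto_0)
  ultimately show ?thesis using assms by (simp add: g_eq)
qed

end

lemma tail_rec_tendsto_inv_tail:
  assumes a: "0 < a" "a < 1" and n: "filterlim n at_top sequentially"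
    and "(\<lambda>k. tail_rec (n k) (s k)) \<longlonglongrightarrow> a"
  shows "(\<lambda>k. tail_rec (n k) (x + s k)) \<longlonglongrightarrow> inv_tail a x"
proof (cases x rule: int_cases2)
  case (nonneg m)
  have "(\<lambda>k. tail_rec (n k) (int m + s k)) \<longlonglongrightarrow> inv_tail a (int m)"
  proof (induction m)
    case (Suc m)
    show ?case unfolding inv_tail_pos
      using Suc inv_tail_bounds[OF a]
      by (intro right_neighbour_tendsto[OF n]) (auto simp: algebra_simps)
  qed (use assms in simp)
  then show ?thesis using nonneg by simp
next
  case (nonpos m)
  have "(\<lambda>k. tail_rec (n k) (- int m + s k)) \<longlonglongrightarrow> inv_tail a (- int m)"
  proof (induction m)
    case (Suc m)
    from left_neighbour_tendsto[OF n this] show ?case unfolding inv_tail_neg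
      by (simp add: algebra_simps)
  qed (use assms in simp)
  then show ?thesis using nonpos by simp
qed

text \<open>
  Left of \<open>-s\<close> the shifted tail is constantly \<open>1\<close> and right of \<open>n - s\<close> constantly \<open>0\<close>, so there
  the distance is monotone and largest at the end points; a finite maximum remains.
\<close>

lemma sup_distance_attained:
  assumes "0 < a" "a < 1"
  obtains y where "\<And>x. \<bar>inv_tail a x - tail_rec n (x + s)\<bar> \<le> \<bar>inv_tail a y - tail_rec n (y + s)\<bar>"
proof -
  define h where "h x = \<bar>inv_tail a x - tail_rec n (x + s)\<bar>" for x
  let ?p = "- s" and ?q = "int n + 1 - s"
  have "finite (h ` {?p..?q})" "h ` {?p..?q} \<noteq> {}" by auto
  then obtain y where y: "h y = Max (h ` {?p..?q})"
    using Max_in by (metis (no_types, lifting) imageE)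
  have in_le: "h x \<le> h y" if "x \<in> {?p..?q}" for x
    unfolding y using that by (intro Max_ge) auto
  have "h x \<le> h y" for x
  proof -
    consider "x \<in> {?p..?q}" | "x \<le> ?p" | "x \<ge> ?q" by force
    then show ?thesis
    proof cases
      case 1
      then show ?thesis by (rule in_le)
    next
      case 2
      then have "h x \<le> h ?p"
        unfolding h_def using antimonoD[OF antimono_inv_tail[OF assms] 2]
          inv_tail_bounds[OF assms, of x] inv_tail_bounds[OF assms, of ?p]
        by (simp add: tail_rec_eq_1)
      then show ?thesis using in_le[of ?p] by simp
    next
      case 3
      then have "h x \<le> h ?q"
        unfolding h_def using antimonoD[OF antimono_inv_tail[OF assms] 3] 
          inv_tail_bounds[OF assms, of x] inv_tail_bounds[OF assms, of ?q]
        by (simp add: tail_rec_eq_0)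
      then show ?thesis using in_le[of ?q] by simp
    qed
  qed
  then show thesis using that[of y] by (simp add: h_def)
qed

theorem theorem5:
  fixes M :: "'w measure" and B :: "bool list \<Rightarrow> 'w \<Rightarrow> real" and a :: real
  assumes "binary_brw M B" and "0 < a" and "a < 1"
  shows "\<exists>(z::int) (n::nat \<Rightarrow> nat) (d::nat \<Rightarrow> real).
           filterlim n at_top sequentially \<and>
           (\<forall>k. (\<exists>x. d k = \<bar>inv_tail a x - brw_F M B (n k) (x + int k - z)\<bar>) \<and>
                (\<forall>x. \<bar>inv_tail a x - brw_F M B (n k) (x + int k - z)\<bar> \<le> d k)) \<and>
           d \<longlonglongrightarrow> 0"
proof -
  note a = assms(2,3)
  let ?n = "passage_time a"
  define h where "h k x = \<bar>inv_tail a x - tail_rec (?n k) (x + int k)\<bar>" for k x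
  have "\<exists>y. \<forall>x. h k x \<le> h k y" for k
    unfolding h_def by (metis sup_distance_attained[OF a])
  then obtain y where y: "h k x \<le> h k (y k)" for k x by metis
  have "antimono (\<lambda>x. tail_rec (?n k) (x + int k))" for k
    by (intro antimonoI antimonoD[OF antimono_tail_rec]) simp
  then have unif: "\<forall>\<^sub>F k in sequentially. \<forall>x. h k x < e" if "0 < e" for e
    unfolding h_def using that
    by (intro uniform_convergence_of_tails antimono_inv_tail inv_tail_bounds inv_tail_tendsto
        tail_rec_bounds tail_rec_tendsto_inv_tail passage_time_at_top
        tail_rec_passage_time_tendsto a)
  have "(\<lambda>k. h k (y k)) \<longlonglongrightarrow> 0"
  proof (rule tendstoI)
    fix e :: real assume "0 < e"
    from unif[OF this] show "\<forall>\<^sub>F k in sequentially. dist (h k (y k)) 0 < e"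
      by eventually_elim (simp add: h_def)
  qed
  moreover have "h k x = \<bar>inv_tail a x - brw_F M B (?n k) (x + int k - 0)\<bar>" for k x
    by (simp add: h_def brw_F_eq_tail_rec[OF assms(1)])
  ultimately show ?thesis
    using y passage_time_at_top[OF a]
    by (intro exI[of _ 0] exI[of _ ?n] exI[of _ "\<lambda>k. h k (y k)"]) auto
qed

end
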